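(* Let $r,m,r'$ be integers with $m\ge 1$ and $1\le r'\le r-1$, and put $n=rm+r'$, $k=n-r$, $l=r^{m+1}$. Let $F$ be a finite field with $|F|\ge r(m+1)$, let $\lambda_1,\dots,\lambda_{r(m+1)}$ be distinct elements of $F$, and let $\gamma\in F\setminus\{0,1\}$. Let $$\mathcal C'=\Big\{(C_1,\dots,C_n)\in (F^l)^n:\ \sum_{i=1}^n A_{t,i}C_i=0,\ t=0,1,\dots,r-1\Big\},$$ where the $l\times l$ matrices $A_{t,i}$, $0\le t\le r-1$, $1\le i\le n$, are those defined in the context. Then $\mathcal C'$ has the optimal access property.
   Context: Conventions: $[n]=\{1,\dots,n\}$; $0^0=1$. Rows and columns of an $l\times l$ matrix $A$ are indexed by $0,1,\dots,l-1$, and $A(a,b)$ denotes the entry in row $a$, column $b$. An $(n,k,l)$ array code over $F$ is an $F$-linear subspace $\mathcal C\subseteq(F^l)^n$ with $\dim_F\mathcal C=kl$; codewords are written $(C_1,\dots,C_n)$ with $C_i=(c_{i,0},\dots,c_{i,l-1})^T\in F^l$ (the $i$-th node). It is MDS if any $k$ of the $n$ columns $C_i$ of a codeword suffice to recover the remaining $n-k$ columns. Access. Let $\mathcal C$ be an $(n,k,l)$ MDS array code, $i\in[n]$ and $R\subseteq[n]\setminus\{i\}$ with $|R|\ge k$. Node $i$ can be repaired from the helper nodes $R$ by accessing $\omega$ symbols if there are nonnegative integers $\beta_{i,j},\omega_{i,j}$ ($j\in R$) with $\sum_{j\in R}\omega_{i,j}=\omega$, functions $f_{i,j}:F^l\to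 F^{\beta_{i,j}}$ ($j\in R$), where $f_{i,j}(C_j)$ depends only on $\omega_{i,j}$ of the coordinates $c_{j,0},\dots,c_{j,l-1}$ of $C_j$, and a function $g_i:F^{\sum_j\beta_{i,j}}\to F^l$ such that $C_i=g_i(f_{i,j}(C_j),j\in R)$ for all codewords. Let $\omega_i^*(R)$ be the smallest such $\omega$, and let $\omega(\mathcal C)=\max_{i\in[n]}\omega_i^*([n]\setminus\{i\})$. An $(n,k,l)$ array code $\mathcal C$ has the optimal access property if it is MDS and $\omega(\mathcal C)=\frac{(n-1)l}{n-k}$. The matrices $A_{t,i}$. For an integer $a$ with $0\le a\le l-1$, write its $r$-ary expansion as $a=(a_{m+1},a_m,\dots,a_1)$, i.e. $a=\sum_{v=1}^{m+1} a_v r^{v-1}$ with $0\le a_v\le r-1$. For $v\in\{1,\dots,m+1\}$ and $0\le u\le r-1$ let $a(v,u)$ be the integer obtained from $a$ by replacing the digit $a_v$ by $u$ and keeping all other digits. Each $i\in[n]$ is written uniquely as $i=(v-1)r+u+1$ where either $v\in[m]$ and $u\in\{0,\dots,r-1\}$, or $v=m+1$ and $u\in\{0,\dots,r'-1\}$. For all such $(v,u)$, all $t=0,\dots,r-1$ and $0\le a,b\le l-1$, $$A_{t,(v-1)r+u+1}(a,b)=\begin{cases}\lambda_{(v-1)r+u+1}^t & \text{if } a_v<u,\ b=a,\\ \gamma\lambda_{(v-1)r+u+1}^t & \text{if } a_v>u,\ b=a,\\ \lambda_{(v-1)r+w+1}^t & \text{if } a_v=u,\ b=a(v,w)\text{ for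 some } w\in\{0,1,\dots,r-1\},\\ 0&\text{otherwise.}\end{cases}$$ *)

theory Defs
  imports
    Complex_Main
    "HOL-Library.FuncSet"
    "HOL-Library.Cardinality"
    "HOL-Library.Function_Algebras"
begin

section \<open>Array codes\<close>

text \<open>
  The dimensions vary with the parameters, so \<open>F\<^sup>l\<close> consists of the functions on \<open>nat\<close>
  supported on \<open>{..<l}\<close>, and \<open>(F\<^sup>l)\<^sup>n\<close> of the families of such vectors supported on
  \<open>{1..n}\<close>.  Padding with zeros makes both honest vector spaces over \<open>F\<close>.
\<close>

definition node_space :: "nat \<Rightarrow> (nat \<Rightarrow> 'f::field) set" where
  "node_space l = {x. \<forall>a. a \<ge> l \<longrightarrow> x a = 0}"

definition array_space :: "nat \<Rightarrow> nat \<Rightarrow> (nat \<Rightarrow> nat \<Rightarrow> 'f::field) set" where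
  "array_space n l =
     {C. (\<forall>i\<in>{1..n}. C i \<in> node_space l) \<and> (\<forall>i. i \<notin> {1..n} \<longrightarrow> C i = (\<lambda>_. 0))}"

definition array_scale :: "'f::field \<Rightarrow> (nat \<Rightarrow> nat \<Rightarrow> 'f) \<Rightarrow> (nat \<Rightarrow> nat \<Rightarrow> 'f)" where
  "array_scale s C = (\<lambda>i a. s * C i a)"

interpretation array: vector_space array_scale
  by unfold_locales (auto simp: array_scale_def fun_eq_iff algebra_simps)

definition array_code :: "nat \<Rightarrow> nat \<Rightarrow> nat \<Rightarrow> (nat \<Rightarrow> nat \<Rightarrow> 'f::field) set \<Rightarrow> bool" where
  "array_code n k l \<C> \<longleftrightarrow>
     \<C> \<subseteq> array_space n l \<and> array.subspace \<C> \<and> array.dim \<C> = k * l"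

definition mds_array_code :: "nat \<Rightarrow> nat \<Rightarrow> nat \<Rightarrow> (nat \<Rightarrow> nat \<Rightarrow> 'f::field) set \<Rightarrow> bool" where
  "mds_array_code n k l \<C> \<longleftrightarrow>
     array_code n k l \<C> \<and>
     (\<forall>S. S \<subseteq> {1..n} \<and> card S = k \<longrightarrow>
        (\<exists>h :: (nat \<Rightarrow> nat \<Rightarrow> 'f) \<Rightarrow> nat \<Rightarrow> nat \<Rightarrow> 'f.
           \<forall>C\<in>\<C>. \<forall>i\<in>{1..n} - S. C i = h (restrict C S) i))"


section \<open>Repair and access\<close>

definition depends_only_on ::
  "nat \<Rightarrow> ((nat \<Rightarrow> 'f::field) \<Rightarrow> 'b) \<Rightarrow> nat set \<Rightarrow> bool" where
  "depends_only_on l f J \<longleftrightarrow>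
     (\<forall>x\<in>node_space l. \<forall>y\<in>node_space l. (\<forall>a\<in>J. x a = y a) \<longrightarrow> f x = f y)"

text \<open>
  Elements of \<open>F\<^sup>\<beta>\<close> are lists of length \<open>\<beta>\<close>.  The argument of \<open>g\<close>, an element of
  \<open>F\<close> to the power \<open>\<Sum>j\<in>R. \<beta> j\<close>, is the concatenation of the helpers' answers in
  increasing order of the node index.
\<close>

definition repairable_with_access ::
  "nat \<Rightarrow> (nat \<Rightarrow> nat \<Rightarrow> 'f::field) set \<Rightarrow> nat \<Rightarrow> nat set \<Rightarrow> nat \<Rightarrow> bool" where
  "repairable_with_access l \<C> i R w \<longleftrightarrow>
     (\<exists>(\<beta> :: nat \<Rightarrow> nat) (\<omega> :: nat \<Rightarrow> nat) (f :: nat \<Rightarrow> (nat \<Rightarrow> 'f) \<Rightarrow> 'f list)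
        (g :: 'f list \<Rightarrow> nat \<Rightarrow> 'f).
        (\<Sum>j\<in>R. \<omega> j) = w \<and>
        (\<forall>j\<in>R. f j \<in> node_space l \<rightarrow> {xs. length xs = \<beta> j}) \<and>
        (\<forall>j\<in>R. \<exists>J. J \<subseteq> {..<l} \<and> card J = \<omega> j \<and> depends_only_on l (f j) J) \<and>
        g \<in> {xs. length xs = (\<Sum>j\<in>R. \<beta> j)} \<rightarrow> node_space l \<and>
        (\<forall>C\<in>\<C>. C i = g (concat (map (\<lambda>j. f j (C j)) (sorted_list_of_set R)))))"

text \<open>
  Only used for MDS codes with \<open>card R \<ge> k\<close>, where accessing every symbol of every helper
  suffices and the minimum therefore exists.
\<close>

definition min_access ::
  "nat \<Rightarrow> (nat \<Rightarrow> nat \<Rightarrow> 'f::field) set \<Rightarrow> nat \<Rightarrow> nat set \<Rightarrow> nat" where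
  "min_access l \<C> i R = (LEAST w. repairable_with_access l \<C> i R w)"

definition code_access :: "nat \<Rightarrow> nat \<Rightarrow> (nat \<Rightarrow> nat \<Rightarrow> 'f::field) set \<Rightarrow> nat" where
  "code_access n l \<C> = Max ((\<lambda>i. min_access l \<C> i ({1..n} - {i})) ` {1..n})"

definition optimal_access ::
  "nat \<Rightarrow> nat \<Rightarrow> nat \<Rightarrow> (nat \<Rightarrow> nat \<Rightarrow> 'f::field) set \<Rightarrow> bool" where
  "optimal_access n k l \<C> \<longleftrightarrow>
     mds_array_code n k l \<C> \<and>
     real (code_access n l \<C>) = (real n - 1) * real l / (real n - real k)"


section \<open>The parity check matrices\<close>

definition digit :: "nat \<Rightarrow> nat \<Rightarrow> nat \<Rightarrow> nat" where
  "digit r v a = a div r ^ (v - 1) mod r"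

text \<open>The digits above position \<open>v\<close>, the new digit \<open>u\<close>, the digits below position \<open>v\<close>.\<close>

definition replace_digit :: "nat \<Rightarrow> nat \<Rightarrow> nat \<Rightarrow> nat \<Rightarrow> nat" where
  "replace_digit r v u a = a div r ^ v * r ^ v + u * r ^ (v - 1) + a mod r ^ (v - 1)"

text \<open>
  In the third case \<open>b\<close> is obtained from \<open>a\<close> by replacing the digit at position \<open>v\<close> by some
  \<open>w < r\<close>; this \<open>w\<close> can only be \<open>digit r v b\<close>, see \<open>parity_block_cases\<close> below.
\<close>

definition parity_block ::
  "nat \<Rightarrow> (nat \<Rightarrow> 'f::field) \<Rightarrow> 'f \<Rightarrow> nat \<Rightarrow> nat \<Rightarrow> nat \<Rightarrow> nat \<Rightarrow> 'f" where
  "parity_block r lam \<gamma> t i a b =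
     (let v = (i - 1) div r + 1; u = (i - 1) mod r in
      if digit r v a < u \<and> b = a then lam i ^ t
      else if digit r v a > u \<and> b = a then \<gamma> * lam i ^ t
      else if digit r v a = u \<and> b = replace_digit r v (digit r v b) a
        then lam ((v - 1) * r + digit r v b + 1) ^ t
      else 0)"

definition parity_code ::
  "nat \<Rightarrow> nat \<Rightarrow> nat \<Rightarrow> (nat \<Rightarrow> 'f::field) \<Rightarrow> 'f \<Rightarrow> (nat \<Rightarrow> nat \<Rightarrow> 'f) set" where
  "parity_code r n l lam \<gamma> =
     {C \<in> array_space n l.
        \<forall>t<r. \<forall>a<l. (\<Sum>i = 1..n. \<Sum>b<l. parity_block r lam \<gamma> t i a b * C i b) = 0}"

lemma digit_replace_digit:
  assumes "v \<ge> 1" "u < r"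
  shows "digit r v (replace_digit r v u a) = u"
proof -
  obtain s where v: "v = Suc s"
    using assms(1) by (cases v) auto
  have "replace_digit r v u a = (a div r ^ v * r + u) * r ^ s + a mod r ^ s"
    by (simp add: replace_digit_def v algebra_simps)
  moreover have "r ^ s > 0"
    using assms(2) by simp
  ultimately have "replace_digit r v u a div r ^ s = a div r ^ v * r + u"
    by simp
  then show ?thesis
    using assms(2) by (simp add: digit_def v)
qed

lemma digit_replace_digit_other:
  assumes "v \<ge> 1" "w \<ge> 1" "w \<noteq> v" "u < r"
  shows "digit r w (replace_digit r v u a) = digit r w a"
proof -
  let ?x = "replace_digit r v u a"
  obtain s where v: "v = Suc s"
    using assms(1) by (cases v) auto
  obtain q where w: "w = Suc q"
    using assms(2) by (cases w) auto
  have pos: "r > 0"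
    using assms(4) by simp
  show ?thesis
  proof (cases "w < v")
    case True
    then have qs: "Suc q \<le> s"
      using v w by simp
    have digit_mod: "digit r w x = x mod r ^ s div r ^ q mod r" for x
    proof -
      have "x mod r ^ s div r ^ q = x div r ^ q mod r ^ (s - q)"
      proof -
        have "r ^ s = r ^ q * r ^ (s - q)"
          using qs by (simp flip: power_add)
        then show ?thesis
          using pos by (simp add: mod_mult2_eq)
      qed
      moreover have "r dvd r ^ (s - q)"
        using qs by (intro dvd_power) simp
      ultimately show ?thesis
        by (simp add: digit_def w mod_mod_cancel)
    qed
    have "?x = (a div r ^ v * r + u) * r ^ s + a mod r ^ s"
      by (simp add: replace_digit_def v algebra_simps)
    then have "?x mod r ^ s = a mod r ^ s"
      by simp
    then show ?thesis
      by (simp add: digit_mod)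
  next
    case False
    then have vq: "v \<le> q"
      using v w assms(3) by simp
    have "u * r ^ s + a mod r ^ s < (u + 1) * r ^ s"
      using pos by simp
    also have "\<dots> \<le> r * r ^ s"
      using assms(4) by (intro mult_right_mono) auto
    finally have "(u * r ^ s + a mod r ^ s) div r ^ v = 0"
      by (simp add: v)
    moreover have "?x = a div r ^ v * r ^ v + (u * r ^ s + a mod r ^ s)"
      by (simp add: replace_digit_def v)
    moreover have "r ^ v > 0"
      using pos by simp
    ultimately have "?x div r ^ v = a div r ^ v"
      by simp
    moreover have "x div r ^ q = x div r ^ v div r ^ (q - v)" for x
      using vq by (simp flip: div_mult2_eq power_add)
    ultimately show ?thesis
      by (simp add: digit_def w)
  qed
qed

lemma parity_block_cases:
  assumes "v \<ge> 1" "u < r"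
  defines "i \<equiv> (v - 1) * r + u + 1"
  shows "digit r v a < u \<Longrightarrow> parity_block r lam \<gamma> t i a a = lam i ^ t"
    and "digit r v a > u \<Longrightarrow> parity_block r lam \<gamma> t i a a = \<gamma> * lam i ^ t"
    and "digit r v a \<noteq> u \<Longrightarrow> b \<noteq> a \<Longrightarrow> parity_block r lam \<gamma> t i a b = 0"
    and "digit r v a = u \<Longrightarrow> w < r \<Longrightarrow> b = replace_digit r v w a \<Longrightarrow>
           parity_block r lam \<gamma> t i a b = lam ((v - 1) * r + w + 1) ^ t"
    and "digit r v a = u \<Longrightarrow> (\<And>w. w < r \<Longrightarrow> b \<noteq> replace_digit r v w a) \<Longrightarrow>
           parity_block r lam \<gamma> t i a b = 0"
proof -
  have *: "(i - 1) div r + 1 = v" "(i - 1) mod r = u"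
    using assms(1,2) by (auto simp: i_def)
  have "r > 0"
    using assms(2) by simp
  then have **: "digit r v b < r" for b
    by (simp add: digit_def)
  show "digit r v a < u \<Longrightarrow> parity_block r lam \<gamma> t i a a = lam i ^ t"
    unfolding parity_block_def * Let_def by simp
  show "digit r v a > u \<Longrightarrow> parity_block r lam \<gamma> t i a a = \<gamma> * lam i ^ t"
    unfolding parity_block_def * Let_def by simp
  show "digit r v a \<noteq> u \<Longrightarrow> b \<noteq> a \<Longrightarrow> parity_block r lam \<gamma> t i a b = 0"
    unfolding parity_block_def * Let_def by simp
  show "parity_block r lam \<gamma> t i a b = lam ((v - 1) * r + w + 1) ^ t"
    if "digit r v a = u" "w < r" "b = replace_digit r v w a"
  proof -
    have "digit r v b = w"
      using digit_replace_digit assms(1) that by simp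
    then show ?thesis
      using that unfolding parity_block_def * Let_def by simp
  qed
  show "digit r v a = u \<Longrightarrow> (\<And>w. w < r \<Longrightarrow> b \<noteq> replace_digit r v w a) \<Longrightarrow>
           parity_block r lam \<gamma> t i a b = 0"
    using **[of b] unfolding parity_block_def * Let_def by auto
qed

end

theory Submission
  imports Defs "HOL-Computational_Algebra.Polynomial"
begin

text \<open>
  In each row \<open>a\<close> the parity checks for \<open>t < r\<close> form a Vandermonde system over all \<open>r * (m + 1)\<close>
  elements \<open>lam j\<close>, so all coefficients vanish as soon as those outside some \<open>r\<close> indices do.  For
  erasures this holds by induction on how many digits of \<open>a\<close> point at erased nodes; it leaves
  \<open>2 \<times> 2\<close> systems with determinant \<open>1 - \<gamma>\<close> up to sign.  For the repair of a node the rows whose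
  digit points at it suffice.  Optimality is the cut-set bound: any \<open>r\<close> helpers together must
  supply at least \<open>l\<close> symbols, and one averages over the helpers.
\<close>

section \<open>Vandermonde systems and averaging over subsets\<close>

text \<open>Weighting the equations by the coefficients of a polynomial that vanishes at every
  \<open>x j\<close> except \<open>x i\<close> isolates \<open>c i\<close>. Its degree is
  \<open>card T - 1 < r\<close>, so the available powers suffice.\<close>

lemma vandermonde_kernel_trivial:
  fixes x c :: "'i \<Rightarrow> 'f::field"
  assumes fin: "finite T" and card: "card T \<le> r" and inj: "inj_on x T"
    and eq: "\<And>t. t < r \<Longrightarrow> (\<Sum>j\<in>T. x j ^ t * c j) = 0" and i: "i \<in> T"
  shows "c i = 0"
proof -
  define p where "p = (\<Prod>j\<in>T - {i}. [:- x j, 1:])"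
  have "degree p \<le> sum (degree \<circ> (\<lambda>j. [:- x j, 1:])) (T - {i})"
    unfolding p_def by (rule degree_prod_sum_le) (use fin in simp)
  also have "\<dots> = card T - 1"
    using fin i by simp
  finally have deg: "degree p \<le> r - 1"
    using card by simp
  \<comment> \<open>Nonemptiness of \<open>T\<close> forces \<open>r > 0\<close>; otherwise the
    truncated \<open>r - 1\<close> would leave one term too many.\<close>
  have "card T > 0"
    using fin i card_gt_0_iff by blast
  then have r: "{..r - 1} = {..<r}"
    using card by auto
  have poly_p: "poly p y = (\<Sum>t<r. coeff p t * y ^ t)" for y
    unfolding poly_altdef r[symmetric]
    by (intro sum.mono_neutral_left) (use deg in \<open>auto simp: coeff_eq_0\<close>)
  have roots: "poly p (x j) = 0" if "j \<in> T" "j \<noteq> i" for j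
    using that fin by (auto simp: p_def poly_prod prod_zero_iff)
  have "poly p (x i) \<noteq> 0"
    using fin inj i by (auto simp: p_def poly_prod prod_zero_iff inj_on_def)
  have "0 = (\<Sum>t<r. coeff p t * (\<Sum>j\<in>T. x j ^ t * c j))"
    using eq by simp
  also have "\<dots> = (\<Sum>j\<in>T. poly p (x j) * c j)"
    unfolding poly_p sum_distrib_left sum_distrib_right
    by (subst sum.swap) (simp add: mult.assoc)
  also have "\<dots> = (\<Sum>j\<in>T. if j = i then poly p (x i) * c i else 0)"
    by (intro sum.cong) (auto simp: roots)
  also have "\<dots> = poly p (x i) * c i"
    using fin i by simp
  finally show ?thesis
    using \<open>poly p (x i) \<noteq> 0\<close> by simp
qed

text \<open>Elements of maximal weight are removed one at a time. Any \<open>r\<close> elements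
  weigh at most \<open>r\<close> times the maximum, so the removed one accounts for its share
  \<open>l / r\<close>; the hypothesis passes to the remaining set as long as it has at least
  \<open>r\<close> elements.\<close>

lemma sum_ge_by_averaging:
  fixes \<omega> :: "'i \<Rightarrow> nat"
  assumes "finite R" and "r \<le> card R"
    and "\<And>Q. Q \<subseteq> R \<Longrightarrow> card Q = r \<Longrightarrow> l \<le> sum \<omega> Q"
  shows "card R * l \<le> r * sum \<omega> R"
  using assms
proof (induction "card R" arbitrary: R)
  case 0
  then show ?case by simp
next
  case (Suc d)
  show ?case
  proof (cases "r = card R")
    case True
    then show ?thesis
      using Suc.prems(3)[of R] by simp
  next
    case False
    have "R \<noteq> {}"
      using Suc.hyps(2) by auto
    define x where "x = (ARG_MAX \<omega> x. x \<in> R)"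
    have "x \<in> R \<and> (\<forall>y\<in>R. \<omega> y \<le> \<omega> x)"
    proof -
      obtain y where y: "y \<in> R"
        using \<open>R \<noteq> {}\<close> by auto
      have "\<forall>y. y \<in> R \<longrightarrow> \<omega> y < Suc (Max (\<omega> ` R))"
        using Suc.prems(1) by (simp add: le_imp_less_Suc)
      from arg_max_nat_lemma[of "\<lambda>x. x \<in> R", OF y this] show ?thesis
        by (auto simp: x_def)
    qed
    then have x: "x \<in> R" and max: "\<And>y. y \<in> R \<Longrightarrow> \<omega> y \<le> \<omega> x"
      by auto
    obtain Q where Q: "Q \<subseteq> R" "card Q = r"
      using obtain_subset_with_card_n[OF Suc.prems(2)] by metis
    have "l \<le> sum \<omega> Q"
      using Suc.prems(3) Q by simp
    also have "\<dots> \<le> r * \<omega> x"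
      using sum_bounded_above[of Q \<omega> "\<omega> x"] Q max by auto
    finally have "l \<le> r * \<omega> x" .
    moreover have "card (R - {x}) * l \<le> r * sum \<omega> (R - {x})"
      using Suc.prems Suc.hyps(2) False x by (intro Suc.hyps(1)) auto
    moreover have "card R = Suc (card (R - {x}))" "sum \<omega> R = \<omega> x + sum \<omega> (R - {x})"
      using Suc.prems(1) x card_Suc_Diff1 sum.remove by (metis, metis)
    ultimately show ?thesis
      by (simp add: algebra_simps)
  qed
qed

section \<open>Digits and node indices\<close>

lemma digit_less: "r > 0 \<Longrightarrow> digit r v a < r"
  by (simp add: digit_def)

lemma replace_digit_digit:
  assumes "v \<ge> 1"
  shows "replace_digit r v (digit r v a) a = a"
proof -
  obtain s where v: "v = Suc s"
    using assms by (cases v) auto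
  have "a div r ^ s = a div r ^ s div r * r + a div r ^ s mod r"
    by simp
  moreover have "a div r ^ s div r = a div r ^ v"
    by (simp add: v div_mult2_eq[symmetric] mult.commute)
  ultimately have "a div r ^ s = a div r ^ v * r + digit r v a"
    by (simp add: digit_def v)
  then have "a div r ^ v * r ^ v + digit r v a * r ^ s = a div r ^ s * r ^ s"
    by (simp add: v algebra_simps)
  then show ?thesis
    by (simp add: replace_digit_def v div_mult_mod_eq)
qed

lemma replace_digit_replace_digit:
  assumes "v \<ge> 1" "y < r"
  shows "replace_digit r v x (replace_digit r v y a) = replace_digit r v x a"
proof -
  obtain s where v: "v = Suc s"
    using assms(1) by (cases v) auto
  have pos: "r ^ s > 0"
    using assms(2) by simp
  have eq: "replace_digit r v y a = (a div r ^ v * r + y) * r ^ s + a mod r ^ s"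
    by (simp add: replace_digit_def v algebra_simps)
  have "replace_digit r v y a div r ^ v = replace_digit r v y a div r ^ s div r"
    by (simp add: v div_mult2_eq[symmetric] mult.commute)
  also have "replace_digit r v y a div r ^ s = a div r ^ v * r + y"
    unfolding eq using pos by simp
  finally have "replace_digit r v y a div r ^ v = a div r ^ v"
    using assms(2) by simp
  moreover have "replace_digit r v y a mod r ^ s = a mod r ^ s"
    unfolding eq by simp
  ultimately show ?thesis
    unfolding replace_digit_def[of r v x] by (simp add: v)
qed

lemma replace_digit_less:
  assumes "1 \<le> v" "v \<le> p" "w < r" "a < r ^ p"
  shows "replace_digit r v w a < r ^ p"
proof -
  obtain s where v: "v = Suc s"
    using assms(1) by (cases v) auto
  have "w * r ^ s + a mod r ^ s < (w + 1) * r ^ s"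
    using assms(3) by simp
  also have "\<dots> \<le> r * r ^ s"
    using assms(3) by (intro mult_right_mono) auto
  finally have "replace_digit r v w a < (a div r ^ v + 1) * r ^ v"
    by (simp add: replace_digit_def v)
  also have "a div r ^ v < r ^ (p - v)"
    using assms(2,4) by (intro less_mult_imp_div_less) (simp flip: power_add)
  then have "(a div r ^ v + 1) * r ^ v \<le> r ^ (p - v) * r ^ v"
    by (intro mult_right_mono) auto
  also have "\<dots> = r ^ p"
    using assms(2) by (simp flip: power_add)
  finally show ?thesis .
qed

text \<open>Replacing the digit maps the \<open>r\<close> classes bijectively onto each other, so
  each holds one \<open>r\<close>-th of the range. This counts the coordinates read at one
  helper.\<close>

lemma card_digit_eq:
  assumes "1 \<le> v" "v \<le> m + 1" "u < r"
  shows "card {a. a < r ^ (m + 1) \<and> digit r v a = u} = r ^ m"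
proof -
  let ?A = "\<lambda>u. {a. a < r ^ (m + 1) \<and> digit r v a = u}"
  have bij: "bij_betw (replace_digit r v w) (?A u) (?A w)" if "w < r" for w
    by (rule bij_betwI[where g = "replace_digit r v u"])
      (use assms that in \<open>auto simp: replace_digit_less[where p = "m + 1", simplified]
        replace_digit_replace_digit digit_replace_digit replace_digit_digit\<close>)
  have "{..<r ^ (m + 1)} = (\<Union>w<r. ?A w)"
    using assms(3) by (auto simp: digit_less)
  then have "r ^ (m + 1) = card (\<Union>w<r. ?A w)"
    by (metis card_lessThan)
  also have "\<dots> = (\<Sum>w<r. card (?A w))"
    by (intro card_UN_disjoint) auto
  also have "\<dots> = (\<Sum>w<r. card (?A u))"
    using bij_betw_same_card[OF bij] by simp
  finally show ?thesis
    using assms(3) by simp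
qed

section \<open>Information sets, dimension and repair\<close>

text \<open>Uniqueness yields erasure recovery, existence yields the freedom needed in the cut-set
  bound, and together they yield the dimension.\<close>

definition information_set :: "nat \<Rightarrow> (nat \<Rightarrow> nat \<Rightarrow> 'f::field) set \<Rightarrow> nat set \<Rightarrow> bool" where
  "information_set l \<C> S \<longleftrightarrow>
     (\<forall>X \<in> S \<rightarrow> node_space l. \<exists>!C. C \<in> \<C> \<and> (\<forall>i\<in>S. C i = X i))"

lemma information_setE:
  assumes "information_set l \<C> S" "\<And>i. i \<in> S \<Longrightarrow> X i \<in> node_space l"
  obtains C where "C \<in> \<C>" "\<And>i. i \<in> S \<Longrightarrow> C i = X i"
proof -
  have "X \<in> S \<rightarrow> node_space l"
    using assms(2) by auto
  then obtain C where "C \<in> \<C> \<and> (\<forall>i\<in>S. C i = X i)"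
    using assms(1) unfolding information_set_def by blast
  then show thesis
    using that by blast
qed

lemma information_set_eqI:
  assumes "information_set l \<C> S" "\<And>i. i \<in> S \<Longrightarrow> C i \<in> node_space l"
    and "C \<in> \<C>" "D \<in> \<C>" "\<And>i. i \<in> S \<Longrightarrow> D i = C i"
  shows "D = C"
proof -
  have "C \<in> S \<rightarrow> node_space l"
    using assms(2) by auto
  then have "\<exists>!D. D \<in> \<C> \<and> (\<forall>i\<in>S. D i = C i)"
    using assms(1) unfolding information_set_def by blast
  then show ?thesis
    using assms(3-5) by blast
qed

lemma sum_fun_apply2: "(\<Sum>p\<in>A. f p) i a = (\<Sum>p\<in>A. f p i a)"
  for f :: "'p \<Rightarrow> nat \<Rightarrow> nat \<Rightarrow> 'f::field"
  by (induction A rule: infinite_finite_induct) (simp_all add: plus_fun_def zero_fun_def)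

text \<open>The codewords that extend the unit patterns on \<open>S\<close> form a basis, one for
  each of the \<open>card S * l\<close> positions.\<close>

lemma dim_eq_information_set:
  fixes \<C> :: "(nat \<Rightarrow> nat \<Rightarrow> 'f::field) set"
  assumes sub: "array.subspace \<C>" and fin: "finite S" and info: "information_set l \<C> S"
    and ns: "\<And>C i. C \<in> \<C> \<Longrightarrow> i \<in> S \<Longrightarrow> C i \<in> node_space l"
  shows "array.dim \<C> = card S * l"
proof -
  define P where "P = S \<times> {..<l}"
  have "\<exists>C\<in>\<C>. \<forall>i\<in>S. C i = (\<lambda>b. if p = (i, b) then 1 else 0)" if p: "p \<in> P" for p
    by (rule information_setE[OF info, where X = "\<lambda>i b. if p = (i, b) then 1 else 0"])
      (use p in \<open>auto simp: node_space_def P_def\<close>)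
  then obtain e where e: "\<And>p. p \<in> P \<Longrightarrow> e p \<in> \<C>"
    "\<And>p i. p \<in> P \<Longrightarrow> i \<in> S \<Longrightarrow> e p i = (\<lambda>b. if p = (i, b) then 1 else 0)"
    by metis
  have e_apply: "e p i a = (if p = (i, a) then 1 else 0)" if "p \<in> P" "i \<in> S" for p i a
    unfolding e(2)[OF that] ..
  have finP: "finite P"
    using fin by (simp add: P_def)
  have inj: "inj_on e P"
  proof (rule inj_onI)
    fix p q assume pq: "p \<in> P" "q \<in> P" "e p = e q"
    obtain i a where p: "p = (i, a)" "i \<in> S"
      using pq(1) by (auto simp: P_def)
    have "e q i a = 1"
      unfolding pq(3)[symmetric] e_apply[OF pq(1) p(2)] using p(1) by simp
    then show "p = q"
      unfolding e_apply[OF pq(2) p(2)] p(1) by (metis zero_neq_one)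
  qed
  \<comment> \<open>The coefficient of \<open>e p\<close> can be read off at position
    \<open>p\<close>. This gives independence, and with uniqueness also spanning: a codeword equals
    the combination weighted by its own entries on \<open>S\<close>.\<close>
  have comb: "(\<Sum>p\<in>P. array_scale (f p) (e p)) i a = f (i, a)"
    if "(i, a) \<in> P" for f i a
  proof -
    have "i \<in> S"
      using that by (simp add: P_def)
    have "(\<Sum>p\<in>P. array_scale (f p) (e p)) i a = (\<Sum>p\<in>P. if p = (i, a) then f p else 0)"
      unfolding sum_fun_apply2 array_scale_def
      by (intro sum.cong) (simp_all add: e_apply \<open>i \<in> S\<close>)
    then show ?thesis
      using that finP by simp
  qed
  have comb_in: "(\<Sum>p\<in>P. array_scale (f p) (e p)) \<in> \<C>" for f
    by (intro array.subspace_sum[OF sub] array.subspace_scale[OF sub] e)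
  show ?thesis
  proof (rule array.dim_unique[where B = "e ` P"])
    show "e ` P \<subseteq> \<C>"
      using e(1) by auto
    show "\<C> \<subseteq> array.span (e ` P)"
    proof
      fix C assume C: "C \<in> \<C>"
      let ?D = "\<Sum>p\<in>P. array_scale (C (fst p) (snd p)) (e p)"
      have "?D = C"
      proof (rule information_set_eqI[OF info ns[OF C] C comb_in])
        fix i assume i: "i \<in> S"
        show "?D i = C i"
        proof
          fix a
          show "?D i a = C i a"
          proof (cases "a < l")
            case True
            then show ?thesis
              using comb[of i a "\<lambda>p. C (fst p) (snd p)"] i by (simp add: P_def)
          next
            case False
            then show ?thesis
              using ns[OF C i] ns[OF comb_in i] by (simp add: node_space_def)
          qed
        qed
      qed
      moreover have "?D \<in> array.span (e ` P)"
        by (intro array.span_sum array.span_scale array.span_base) auto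
      ultimately show "C \<in> array.span (e ` P)"
        by simp
    qed
    show "array.independent (e ` P)"
    proof (rule array.independent_if_scalars_zero)
      show "finite (e ` P)"
        using finP by simp
      fix f x assume 0: "(\<Sum>x\<in>e ` P. array_scale (f x) x) = 0" and "x \<in> e ` P"
      then obtain i a where p: "(i, a) \<in> P" "x = e (i, a)"
        by auto
      have "(\<Sum>p\<in>P. array_scale (f (e p)) (e p)) = 0"
        using 0 by (simp add: sum.reindex[OF inj])
      then show "f x = 0"
        using comb[OF p(1), of "\<lambda>p. f (e p)"] p(2) by simp
    qed
    show "card (e ` P) = card S * l"
      unfolding card_image[OF inj] by (simp add: P_def card_cartesian_product)
  qed
qed

lemma mds_array_codeI:
  fixes \<C> :: "(nat \<Rightarrow> nat \<Rightarrow> 'f::field) set"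
  assumes sub: "array.subspace \<C>" and arr: "\<C> \<subseteq> array_space n l" and "k \<le> n"
    and info: "\<And>S. S \<subseteq> {1..n} \<Longrightarrow> card S = k \<Longrightarrow> information_set l \<C> S"
  shows "mds_array_code n k l \<C>"
proof -
  have ns: "C i \<in> node_space l" if "C \<in> \<C>" "i \<in> {1..n}" for C i
    using arr that by (auto simp: array_space_def)
  obtain S where S: "S \<subseteq> {1..n}" "card S = k"
    using obtain_subset_with_card_n[of k "{1..n}"] \<open>k \<le> n\<close> by auto
  have "array.dim \<C> = k * l"
    unfolding S(2)[symmetric] using S(1) ns
    by (intro dim_eq_information_set[OF sub finite_subset[OF S(1)] info[OF S]]) auto
  moreover have "\<exists>h. \<forall>C\<in>\<C>. \<forall>i\<in>{1..n} - S. C i = h (restrict C S) i"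
    if S: "S \<subseteq> {1..n}" "card S = k" for S
  proof (intro exI ballI)
    fix C i assume C: "C \<in> \<C>"
    \<comment> \<open>The recovery map picks any codeword with the given contents on
      \<open>S\<close>; uniqueness makes it the original one.\<close>
    define D where "D = (SOME D. D \<in> \<C> \<and> restrict D S = restrict C S)"
    have D: "D \<in> \<C> \<and> restrict D S = restrict C S"
      unfolding D_def
      by (rule someI[where P = "\<lambda>D. D \<in> \<C> \<and> restrict D S = restrict C S", OF conjI, OF C refl])
    have "D j = C j" if "j \<in> S" for j
      using fun_cong[OF conjunct2[OF D], of j] that by simp
    then have "D = C"
      using ns[OF C] S(1) by (intro information_set_eqI[OF info[OF S] _ C conjunct1[OF D]]) auto
    then show "C i = (\<lambda>X. SOME D. D \<in> \<C> \<and> restrict D S = X) (restrict C S) i"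
      unfolding D_def by simp
  qed
  ultimately show ?thesis
    using sub arr by (simp add: mds_array_code_def array_code_def)
qed

section \<open>Lower and upper bounds on the access of a repair\<close>

text \<open>A counting substitute for a rank argument: \<open>q ^ card A <= q ^ card B\<close> with
  \<open>q > 1\<close>. The map need not be linear.\<close>

lemma card_PiE_UNIV_le_imp_card_le:
  fixes \<Phi> :: "('a \<Rightarrow> 'f::{finite,zero_neq_one}) \<Rightarrow> ('b \<Rightarrow> 'f)"
  assumes "finite A" "finite B" "inj_on \<Phi> (PiE A (\<lambda>_. UNIV))"
    and "\<Phi> ` PiE A (\<lambda>_. UNIV) \<subseteq> PiE B (\<lambda>_. UNIV)"
  shows "card A \<le> card B"
proof -
  have "card (PiE A (\<lambda>_. UNIV :: 'f set)) \<le> card (PiE B (\<lambda>_. UNIV :: 'f set))"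
    using assms by (intro card_inj_on_le[of \<Phi>]) (auto simp: finite_PiE)
  then have "CARD('f) ^ card A \<le> CARD('f) ^ card B"
    using assms(1,2) by (simp add: card_PiE)
  moreover have "CARD('f) > 1"
    using card_mono[of "UNIV :: 'f set" "{0, 1}"] by simp
  ultimately show ?thesis
    by simp
qed

text \<open>
  Fix the codeword to be zero on \<open>k - 1\<close> helpers.  Node \<open>i\<close> then still takes all values, so the
  symbols accessed at the remaining helpers must distinguish all of them.
\<close>

lemma repairable_with_access_ge:
  fixes \<C> :: "(nat \<Rightarrow> nat \<Rightarrow> 'f::{field,finite}) set"
  assumes arr: "\<C> \<subseteq> array_space n l" and k: "1 \<le> k" "k < n" and i: "i \<in> {1..n}"
    and info: "\<And>S. S \<subseteq> {1..n} \<Longrightarrow> card S = k \<Longrightarrow> information_set l \<C> S"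
    and rep: "repairable_with_access l \<C> i ({1..n} - {i}) w"
  shows "(n - 1) * l \<le> (n - k) * w"
proof -
  define R where "R = {1..n} - {i}"
  have R: "finite R" "card R = n - 1"
    using i by (auto simp: R_def)
  obtain \<omega> :: "nat \<Rightarrow> nat" and f :: "nat \<Rightarrow> (nat \<Rightarrow> 'f) \<Rightarrow> 'f list" and g
    where \<omega>: "sum \<omega> R = w"
    and acc: "\<forall>j\<in>R. \<exists>J. J \<subseteq> {..<l} \<and> card J = \<omega> j \<and> depends_only_on l (f j) J"
    and g: "\<forall>C\<in>\<C>. C i = g (concat (map (\<lambda>j. f j (C j)) (sorted_list_of_set R)))"
    using rep unfolding repairable_with_access_def R_def by blast
  obtain J where J: "\<And>j. j \<in> R \<Longrightarrow> J j \<subseteq> {..<l}" "\<And>j. j \<in> R \<Longrightarrow> card (J j) = \<omega> j"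
    "\<And>j. j \<in> R \<Longrightarrow> depends_only_on l (f j) (J j)"
    using acc by metis
  have ns: "C j \<in> node_space l" if "C \<in> \<C>" "j \<in> {1..n}" for C j
    using arr that by (auto simp: array_space_def)
  have "l \<le> sum \<omega> Q" if Q: "Q \<subseteq> R" "card Q = n - k" for Q
  proof -
    have finQ: "finite Q"
      using Q R finite_subset by blast
    \<comment> \<open>\<open>P\<close> collects the \<open>k - 1\<close> helpers held at zero; with
      the failed node they make up an information set.\<close>
    define P where "P = R - Q"
    define S where "S = insert i P"
    have "finite P" "i \<notin> P" "card P = k - 1"
      using Q R k finQ by (auto simp: P_def R_def card_Diff_subset)
    then have S: "S \<subseteq> {1..n}" "card S = k"
      using i k by (auto simp: S_def P_def R_def)
    define Y where "Y x j b = (if j = i \<and> b < l then x b else 0)" for x :: "nat \<Rightarrow> 'f" and j b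
    have "\<exists>C\<in>\<C>. \<forall>j\<in>S. C j = Y x j" for x
      by (rule information_setE[OF info[OF S], of "Y x"]) (auto simp: Y_def node_space_def)
    then obtain E where E: "\<And>x. E x \<in> \<C>" "\<And>x j. j \<in> S \<Longrightarrow> E x j = Y x j"
      by metis
    \<comment> \<open>\<open>\<Phi> x\<close> records the symbols accessed at the helpers in
      \<open>Q\<close> when node \<open>i\<close> stores \<open>x\<close>.\<close>
    define \<Phi> where "\<Phi> x = restrict (\<lambda>(j, a). E x j a) (Sigma Q J)" for x
    have finJ: "finite (J j)" if "j \<in> Q" for j
      using J(1)[of j] Q that finite_subset by blast
    have "inj_on \<Phi> (PiE {..<l} (\<lambda>_. UNIV))"
    proof (rule inj_onI)
      fix x y assume xy: "x \<in> PiE {..<l} (\<lambda>_. UNIV)" "y \<in> PiE {..<l} (\<lambda>_. UNIV)" "\<Phi> x = \<Phi> y"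
      \<comment> \<open>Helpers in \<open>Q\<close> answer alike because the symbols they access
        agree, the others because they store zero in both codewords. The repair then returns the
        same node, so \<open>x = y\<close>.\<close>
      have "f j (E x j) = f j (E y j)" if j: "j \<in> R" for j
      proof (cases "j \<in> Q")
        case True
        have "E x j a = E y j a" if "a \<in> J j" for a
          using fun_cong[OF xy(3), of "(j, a)"] True that by (simp add: \<Phi>_def)
        moreover have "j \<in> {1..n}"
          using j by (simp add: R_def)
        ultimately show ?thesis
          using J(3)[OF j] ns[OF E(1)] by (simp add: depends_only_on_def)
      next
        case False
        then have "j \<in> S" "j \<noteq> i"
          using j by (auto simp: S_def P_def R_def)
        then show ?thesis
          unfolding E(2)[OF \<open>j \<in> S\<close>] Y_def by simp
      qed
      then have "map (\<lambda>j. f j (E x j)) (sorted_list_of_set R)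
          = map (\<lambda>j. f j (E y j)) (sorted_list_of_set R)"
        using R(1) by (intro map_cong) auto
      then have "E x i = E y i"
        using g E(1) by metis
      then have "Y x i a = Y y i a" for a
        by (simp add: E(2) S_def)
      then have "x a = y a" if "a < l" for a
        using that unfolding Y_def by presburger
      then show "x = y"
        by (intro PiE_ext[OF xy(1,2)]) simp
    qed
    moreover have "\<Phi> ` PiE {..<l} (\<lambda>_. UNIV) \<subseteq> PiE (Sigma Q J) (\<lambda>_. UNIV)"
      unfolding \<Phi>_def image_subset_iff restrict_PiE_iff by simp
    ultimately have "card {..<l} \<le> card (Sigma Q J)"
      using finQ finJ by (intro card_PiE_UNIV_le_imp_card_le) auto
    also have "\<dots> = (\<Sum>j\<in>Q. \<omega> j)"
      using finQ finJ J(2) Q(1) by (subst card_SigmaI) (auto intro!: sum.cong)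
    finally show ?thesis
      by simp
  qed
  then have "card R * l \<le> (n - k) * sum \<omega> R"
    using R k by (intro sum_ge_by_averaging) auto
  then show ?thesis
    using R \<omega> by simp
qed

text \<open>The helpers send the accessed symbols uncoded; the repair picks any codeword compatible
  with the answers and reads off node \<open>i\<close>.\<close>

lemma repairable_with_access_coordinates:
  fixes \<C> :: "(nat \<Rightarrow> nat \<Rightarrow> 'f::field) set"
  assumes R: "finite R" and J: "\<And>j. j \<in> R \<Longrightarrow> J j \<subseteq> {..<l}"
    and ns: "\<And>C. C \<in> \<C> \<Longrightarrow> C i \<in> node_space l"
    and det: "\<And>C D. C \<in> \<C> \<Longrightarrow> D \<in> \<C> \<Longrightarrow> (\<And>j a. j \<in> R \<Longrightarrow> a \<in> J j \<Longrightarrow> C j a = D j a) \<Longrightarrow>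
      C i = D i"
  shows "repairable_with_access l \<C> i R (\<Sum>j\<in>R. card (J j))"
proof -
  define f where "f j x = map x (sorted_list_of_set (J j))" for j and x :: "nat \<Rightarrow> 'f"
  define G where "G C = concat (map (\<lambda>j. f j (C j)) (sorted_list_of_set R))"
    for C :: "nat \<Rightarrow> nat \<Rightarrow> 'f"
  \<comment> \<open>The default zero keeps \<open>g\<close> inside \<open>node_space l\<close> on
    answers that no codeword produces.\<close>
  define g where "g xs = (if \<exists>C\<in>\<C>. G C = xs then (SOME C. C \<in> \<C> \<and> G C = xs) i else (\<lambda>_. 0))" for xs
  have finJ: "finite (J j)" if "j \<in> R" for j
    using J[OF that] finite_subset by blast
  have eq: "C i = D i" if CD: "C \<in> \<C>" "D \<in> \<C>" "G C = G D" for C D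
  proof (rule det[OF CD(1,2)])
    fix j a assume ja: "j \<in> R" "a \<in> J j"
    \<comment> \<open>The concatenation can be split again, since the length of each answer depends
      on the helper alone.\<close>
    have "map (\<lambda>j. f j (C j)) (sorted_list_of_set R) = map (\<lambda>j. f j (D j)) (sorted_list_of_set R)"
      using CD(3) unfolding G_def
      by (rule concat_injective) (auto simp: zip_map_map f_def zip_same_conv_map)
    then have "f j (C j) = f j (D j)"
      using R ja by simp
    then show "C j a = D j a"
      using finJ[OF ja(1)] ja(2) by (simp add: f_def)
  qed
  have some: "(SOME C. C \<in> \<C> \<and> G C = xs) \<in> \<C> \<and> G (SOME C. C \<in> \<C> \<and> G C = xs) = xs"
    if "\<exists>C\<in>\<C>. G C = xs" for xs
    by (rule someI_ex[where P = "\<lambda>C. C \<in> \<C> \<and> G C = xs"]) (use that in blast)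
  have g1: "g xs \<in> node_space l" for xs
  proof (cases "\<exists>C\<in>\<C>. G C = xs")
    case True
    then show ?thesis
      using ns some[OF True] unfolding g_def by presburger
  next
    case False
    then have "g xs = (\<lambda>_. 0)"
      unfolding g_def by presburger
    then show ?thesis
      by (simp add: node_space_def)
  qed
  have g2: "C i = g (G C)" if C: "C \<in> \<C>" for C
  proof -
    have ex: "\<exists>D\<in>\<C>. G D = G C"
      using C by blast
    have "C i = (SOME D. D \<in> \<C> \<and> G D = G C) i"
      using some[OF ex] by (intro eq[OF C]) presburger+
    then show ?thesis
      using ex unfolding g_def by presburger
  qed
  show ?thesis
    unfolding repairable_with_access_def
  proof (intro exI conjI ballI)
    show "(\<Sum>j\<in>R. card (J j)) = (\<Sum>j\<in>R. card (J j))" ..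
    show "f j \<in> node_space l \<rightarrow> {xs. length xs = card (J j)}" for j
      by (simp add: f_def)
    show "J j \<subseteq> {..<l}" if "j \<in> R" for j
      by (rule J[OF that])
    show "card (J j) = card (J j)" for j ..
    show "depends_only_on l (f j) (J j)" if "j \<in> R" for j
      using finJ[OF that] by (auto simp: depends_only_on_def f_def)
    show "g \<in> {xs. length xs = (\<Sum>j\<in>R. card (J j))} \<rightarrow> node_space l"
      using g1 by blast
    show "C i = g (concat (map (\<lambda>j. f j (C j)) (sorted_list_of_set R)))" if "C \<in> \<C>" for C
      using g2[OF that] unfolding G_def .
  qed
qed

section \<open>The parity check equations\<close>

locale parity_setup =
  fixes r m r' n k l :: nat
    and lam :: "nat \<Rightarrow> 'f::{field,finite}"
    and \<gamma> :: 'f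
  assumes m: "m \<ge> 1"
    and r': "1 \<le> r'" "r' \<le> r - 1"
    and n: "n = r * m + r'"
    and k: "k = n - r"
    and l: "l = r ^ (m + 1)"
    and lam: "inj_on lam {1..r * (m + 1)}"
    and \<gamma>: "\<gamma> \<noteq> 0" "\<gamma> \<noteq> 1"
begin

text \<open>\<open>grp\<close> and \<open>pos\<close> give the pair \<open>(v, u)\<close> with
  \<open>i = (v - 1) * r + u + 1\<close>, and \<open>node\<close> inverts them. All
  \<open>m + 1\<close> groups are taken to be full: the indices above \<open>n\<close> act as absent
  nodes with zero contents.\<close>

definition grp :: "nat \<Rightarrow> nat" where "grp i = (i - 1) div r + 1"

definition pos :: "nat \<Rightarrow> nat" where "pos i = (i - 1) mod r"

definition node :: "nat \<Rightarrow> nat \<Rightarrow> nat" where "node v w = (v - 1) * r + w + 1"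

abbreviation dig :: "nat \<Rightarrow> nat \<Rightarrow> nat" where "dig \<equiv> digit r"

abbreviation rep :: "nat \<Rightarrow> nat \<Rightarrow> nat \<Rightarrow> nat" where "rep \<equiv> replace_digit r"

lemma r_pos: "r > 0"
  using r' by simp

lemma r_le_n: "r \<le> n"
  using m n by (simp add: trans_le_add1)

lemma k_bounds: "1 \<le> k" "k < n"
proof -
  have "r \<le> r * m"
    using m by simp
  then show "1 \<le> k" "k < n"
    using n k r' r_pos by linarith+
qed

lemma n_le: "n \<le> r * (m + 1)"
  using n r' by simp

lemma dig_less: "dig v a < r"
  using r_pos by (rule digit_less)

lemma grp_node [simp]: "1 \<le> v \<Longrightarrow> w < r \<Longrightarrow> grp (node v w) = v"
  and pos_node [simp]: "1 \<le> v \<Longrightarrow> w < r \<Longrightarrow> pos (node v w) = w"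
  by (auto simp: grp_def pos_def node_def)

lemma node_grp_pos [simp]: "1 \<le> i \<Longrightarrow> node (grp i) (pos i) = i"
  by (simp add: grp_def pos_def node_def)

lemma grp_ge [simp]: "1 \<le> grp i" "Suc 0 \<le> grp i"
  by (simp_all add: grp_def)

lemma pos_less [simp]: "pos i < r"
  using r_pos by (simp add: pos_def)

lemma grp_le: "1 \<le> i \<Longrightarrow> i \<le> r * (m + 1) \<Longrightarrow> grp i \<le> m + 1"
proof -
  assume "1 \<le> i" "i \<le> r * (m + 1)"
  then have "i - 1 < (m + 1) * r"
    by (simp add: mult.commute)
  then show ?thesis
    using less_mult_imp_div_less[of "i - 1" "m + 1" r] by (simp add: grp_def)
qed

lemma node_in: "1 \<le> v \<Longrightarrow> v \<le> m + 1 \<Longrightarrow> w < r \<Longrightarrow> node v w \<in> {1..r * (m + 1)}"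
proof -
  assume v: "1 \<le> v" "v \<le> m + 1" and w: "w < r"
  have "node v w \<le> (v - 1) * r + r"
    using w by (simp add: node_def)
  also have "\<dots> = v * r"
    using v by (cases v) auto
  also have "\<dots> \<le> (m + 1) * r"
    using v by (intro mult_right_mono) auto
  finally show ?thesis
    by (simp add: node_def mult.commute)
qed

lemma sum_nodes:
  fixes f :: "nat \<Rightarrow> 'b::comm_monoid_add"
  shows "(\<Sum>i = 1..r * (m + 1). f i) = (\<Sum>v = 1..m + 1. \<Sum>w<r. f (node v w))"
proof -
  have "bij_betw (\<lambda>(v, w). node v w) ({1..m + 1} \<times> {..<r}) {1..r * (m + 1)}"
    by (rule bij_betwI[where g = "\<lambda>i. (grp i, pos i)"])
      (use node_in grp_le in \<open>auto simp del: One_nat_def\<close>)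
  from sum.reindex_bij_betw[OF this, of f] show ?thesis
    by (simp add: sum.cartesian_product case_prod_unfold)
qed

lemma rep_less: "1 \<le> v \<Longrightarrow> v \<le> m + 1 \<Longrightarrow> w < r \<Longrightarrow> a < l \<Longrightarrow> rep v w a < l"
  unfolding l by (rule replace_digit_less)

lemma block_sum:
  assumes v: "1 \<le> v" "v \<le> m + 1" and u: "u < r" and a: "a < l"
  shows "(\<Sum>b<l. parity_block r lam \<gamma> t (node v u) a b * x b) =
    (if dig v a = u then \<Sum>w<r. lam (node v w) ^ t * x (rep v w a)
     else (if dig v a < u then 1 else \<gamma>) * lam (node v u) ^ t * x a)"
proof (cases "dig v a = u")
  case False
  have "(\<Sum>b<l. parity_block r lam \<gamma> t (node v u) a b * x b) =
      (\<Sum>b<l. if b = a then parity_block r lam \<gamma> t (node v u) a a * x a else 0)"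
    using parity_block_cases(3)[OF v(1) u False, of _ lam \<gamma> t]
    by (intro sum.cong) (auto simp: node_def)
  also have "\<dots> = parity_block r lam \<gamma> t (node v u) a a * x a"
    using a by simp
  also have "parity_block r lam \<gamma> t (node v u) a a = (if dig v a < u then 1 else \<gamma>) * lam (node v u) ^ t"
    using parity_block_cases(1,2)[OF v(1) u, of a lam \<gamma> t] False by (auto simp: node_def)
  finally show ?thesis
    using False by simp
next
  case True
  \<comment> \<open>The row is supported on the \<open>r\<close> indices that differ from
    \<open>a\<close> at most in digit \<open>v\<close>; that digit recovers \<open>w\<close>, so the
    sum may run over \<open>w\<close> instead.\<close>
  have inj: "inj_on (\<lambda>w. rep v w a) {..<r}"
    by (rule inj_on_inverseI[where g = "dig v"]) (use v in \<open>simp add: digit_replace_digit\<close>)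
  have "(\<Sum>b<l. parity_block r lam \<gamma> t (node v u) a b * x b) =
      (\<Sum>b\<in>(\<lambda>w. rep v w a) ` {..<r}. parity_block r lam \<gamma> t (node v u) a b * x b)"
    using parity_block_cases(5)[OF v(1) u True, of _ lam \<gamma> t] rep_less[OF v _ a]
    by (intro sum.mono_neutral_right) (auto simp: node_def)
  also have "\<dots> = (\<Sum>w<r. parity_block r lam \<gamma> t (node v u) a (rep v w a) * x (rep v w a))"
    by (simp add: sum.reindex[OF inj])
  also have "\<dots> = (\<Sum>w<r. lam (node v w) ^ t * x (rep v w a))"
    using parity_block_cases(4)[OF v(1) u True, of _ _ lam \<gamma> t]
    by (intro sum.cong) (auto simp: node_def)
  finally show ?thesis
    using True by simp
qed

section \<open>Syndromes and erasure correction\<close>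

definition syn :: "(nat \<Rightarrow> nat \<Rightarrow> 'f) \<Rightarrow> nat \<Rightarrow> nat \<Rightarrow> 'f" where
  "syn C t a = (\<Sum>i = 1..n. \<Sum>b<l. parity_block r lam \<gamma> t i a b * C i b)"

text \<open>The coefficient of \<open>lam j ^ t\<close> in \<open>syn C t a\<close>; also needed for the absent nodes \<open>j > n\<close>.\<close>

definition coef :: "(nat \<Rightarrow> nat \<Rightarrow> 'f) \<Rightarrow> nat \<Rightarrow> nat \<Rightarrow> 'f" where
  "coef C a j =
     (if dig (grp j) a = pos j then 0 else (if dig (grp j) a < pos j then 1 else \<gamma>) * C j a) +
     C (node (grp j) (dig (grp j) a)) (rep (grp j) (pos j) a)"

text \<open>Row \<open>a\<close> is sorted by powers of the \<open>lam j\<close>. In each group, the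
  node that the digit of \<open>a\<close> points at contributes to all \<open>r\<close> powers of
  the group, and every other node only to its own.\<close>

lemma syn_eq:
  assumes C: "C \<in> array_space n l" and a: "a < l"
  shows "syn C t a = (\<Sum>j = 1..r * (m + 1). lam j ^ t * coef C a j)"
proof -
  let ?B = "\<lambda>i. \<Sum>b<l. parity_block r lam \<gamma> t i a b * C i b"
  \<comment> \<open>The absent nodes are added with zero contents.\<close>
  have "syn C t a = (\<Sum>i = 1..r * (m + 1). ?B i)"
    unfolding syn_def using C n_le
    by (intro sum.mono_neutral_left) (auto simp: array_space_def)
  also have "\<dots> = (\<Sum>v = 1..m + 1. \<Sum>u<r. ?B (node v u))"
    by (rule sum_nodes)
  also have "\<dots> = (\<Sum>v = 1..m + 1. \<Sum>w<r. lam (node v w) ^ t * coef C a (node v w))"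
  proof (rule sum.cong[OF refl])
    fix v assume "v \<in> {1..m + 1}"
    then have v: "1 \<le> v" "v \<le> m + 1"
      by auto
    let ?e = "\<lambda>u. if dig v a = u then 0 else (if dig v a < u then 1 else \<gamma>) * C (node v u) a"
    have "(\<Sum>u<r. ?B (node v u)) = (\<Sum>u<r. lam (node v u) ^ t * ?e u +
        (if u = dig v a then \<Sum>w<r. lam (node v w) ^ t * C (node v u) (rep v w a) else 0))"
      using v a by (intro sum.cong) (auto simp: block_sum)
    also have "\<dots> = (\<Sum>u<r. lam (node v u) ^ t * ?e u) +
        (\<Sum>w<r. lam (node v w) ^ t * C (node v (dig v a)) (rep v w a))"
      using dig_less by (simp add: sum.distrib)
    also have "\<dots> = (\<Sum>w<r. lam (node v w) ^ t * coef C a (node v w))"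
      unfolding sum.distrib[symmetric] using v
      by (intro sum.cong) (auto simp: coef_def distrib_left)
    finally show "(\<Sum>u<r. ?B (node v u)) = (\<Sum>w<r. lam (node v w) ^ t * coef C a (node v w))" .
  qed
  also have "\<dots> = (\<Sum>j = 1..r * (m + 1). lam j ^ t * coef C a j)"
    by (rule sum_nodes[symmetric])
  finally show ?thesis .
qed

text \<open>The checks of one row are a Vandermonde system in the coefficients. \<open>T\<close>
  will be the set of erased nodes in decoding, and a whole group in repair.\<close>

lemma coef_eq_0:
  assumes C: "C \<in> array_space n l" and a: "a < l"
    and syn: "\<And>t. t < r \<Longrightarrow> syn C t a = 0"
    and T: "T \<subseteq> {1..r * (m + 1)}" "card T \<le> r"
    and zero: "\<And>j. j \<in> {1..r * (m + 1)} \<Longrightarrow> j \<notin> T \<Longrightarrow> coef C a j = 0"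
    and j: "j \<in> T"
  shows "coef C a j = 0"
proof (rule vandermonde_kernel_trivial[OF _ T(2) inj_on_subset[OF lam T(1)] _ j])
  show "finite T"
    using T(1) finite_subset by blast
  fix t assume "t < r"
  then have "0 = (\<Sum>j = 1..r * (m + 1). lam j ^ t * coef C a j)"
    using syn_eq[OF C a] syn by simp
  also have "\<dots> = (\<Sum>j\<in>T. lam j ^ t * coef C a j)"
    using T(1) zero by (intro sum.mono_neutral_right) auto
  finally show "(\<Sum>j\<in>T. lam j ^ t * coef C a j) = 0"
    by simp
qed

text \<open>
  Induction on the number of groups \<open>v\<close> in which the digit of \<open>a\<close> points at an erased node: a
  coefficient at a non-erased node only involves entries of smaller number.
\<close>

lemma erasure_trivial:
  assumes C: "C \<in> array_space n l" and syn: "\<And>t a. t < r \<Longrightarrow> a < l \<Longrightarrow> syn C t a = 0"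
    and T: "T \<subseteq> {1..n}" "card T \<le> r" and zero: "\<And>i. i \<notin> T \<Longrightarrow> C i = (\<lambda>_. 0)"
    and a: "a < l"
  shows "C j a = 0"
  using a
proof (induction "card {v \<in> {1..m + 1}. node v (dig v a) \<in> T}" arbitrary: a j rule: less_induct)
  case less
  let ?N = "\<lambda>a. {v \<in> {1..m + 1}. node v (dig v a) \<in> T}"
  have TN: "T \<subseteq> {1..r * (m + 1)}"
    using T(1) n_le by auto
  \<comment> \<open>All rows with the same number as \<open>a\<close> are covered, because the
    second equation of the \<open>2 \<times> 2\<close> system comes from another such row.\<close>
  have coef: "coef C b j = 0" if b: "b < l" "card (?N b) = card (?N a)" and j: "j \<in> T" for b j
  proof (rule coef_eq_0[OF C b(1) syn[OF _ b(1)] TN T(2) _ j])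
    fix j assume j: "j \<in> {1..r * (m + 1)}" "j \<notin> T"
    let ?v = "grp j" and ?b = "rep (grp j) (pos j) b"
    have v: "1 \<le> ?v" "?v \<le> m + 1"
      using grp_le j by auto
    have "C (node ?v (dig ?v b)) ?b = 0"
    proof (cases "node ?v (dig ?v b) \<in> T")
      case True
      \<comment> \<open>Redirecting the digit from an erased node to the intact node
        \<open>j\<close> removes this group and leaves the other digits alone.\<close>
      have "?N ?b \<subset> ?N b"
      proof
        show "?N ?b \<subseteq> ?N b"
        proof
          fix w assume w: "w \<in> ?N ?b"
          then have "w \<noteq> ?v"
            using j by (auto simp: digit_replace_digit)
          then show "w \<in> ?N b"
            using w by (auto simp: digit_replace_digit_other)
        qed
        have "?v \<in> ?N b" "?v \<notin> ?N ?b"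
          using True v j by (auto simp: digit_replace_digit)
        then show "?N ?b \<noteq> ?N b"
          by blast
      qed
      then have "card (?N ?b) < card (?N a)"
        unfolding b(2)[symmetric] by (intro psubset_card_mono) auto
      then show ?thesis
        using less.hyps rep_less[OF v pos_less b(1)] by blast
    qed (simp add: zero)
    then show "coef C b j = 0"
      using zero[OF j(2)] by (simp add: coef_def)
  qed
  show ?case
  proof (cases "j \<in> T")
    case False
    then show ?thesis
      by (simp add: zero)
  next
    case j: True
    define v where "v = grp j"
    define i where "i = node v (dig v a)"
    define b where "b = rep v (pos j) a"
    have jN: "1 \<le> j" "j \<le> r * (m + 1)"
      using j TN by auto
    then have v: "1 \<le> v" "v \<le> m + 1"
      using grp_le by (auto simp: v_def)
    have jv: "node v (pos j) = j"
      using jN by (simp add: v_def)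
    have ja: "(if dig v a = pos j then 0 else (if dig v a < pos j then 1 else \<gamma>) * C j a) + C i b = 0"
      using coef[OF less.prems refl j] unfolding coef_def v_def i_def b_def .
    show ?thesis
    proof (cases "dig v a = pos j")
      case True
      then have "b = a" "i = j"
        using replace_digit_digit[OF v(1), of r a] jv by (simp_all add: b_def i_def)
      then show ?thesis
        using ja True by simp
    next
      case ne: False
      show ?thesis
      proof (cases "i \<in> T")
        case False
        \<comment> \<open>Here \<open>C i\<close> vanishes, and the factor of \<open>C j a\<close>
          is 1 or \<open>\<gamma>\<close>, hence nonzero.\<close>
        then show ?thesis
          using ja ne \<gamma> zero[OF False] by (auto split: if_splits)
      next
        case i: True
        have bl: "b < l"
          unfolding b_def using rep_less v less.prems by simp
        have dv: "dig v b = pos j"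
          using v by (simp add: b_def digit_replace_digit)
        have solve: "x = 0 \<and> y = 0" if "x + y = 0" "\<gamma> * x + y = 0" for x y
        proof -
          have "(\<gamma> - 1) * x = \<gamma> * x + y - (x + y)"
            by (simp add: algebra_simps)
          then have "x = 0"
            using that \<gamma> by simp
          then show ?thesis
            using that by simp
        qed
        \<comment> \<open>In group \<open>v\<close> the digit of \<open>a\<close> points at
          \<open>i\<close> and that of \<open>b\<close> at \<open>j\<close>; both are
          erased.\<close>
        have "?N b = ?N a"
        proof (rule Collect_cong)
          fix w
          show "w \<in> {1..m + 1} \<and> node w (dig w b) \<in> T \<longleftrightarrow> w \<in> {1..m + 1} \<and> node w (dig w a) \<in> T"
          proof (cases "w = v")
            case True
            then show ?thesis
              using dv jv j i by (simp add: i_def)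
          next
            case False
            then show ?thesis
              using v by (auto simp: b_def digit_replace_digit_other)
          qed
        qed
        then have "coef C b i = 0"
          using coef[OF bl _ i] by simp
        moreover have "rep v (dig v a) b = a"
          using v by (simp add: b_def replace_digit_replace_digit replace_digit_digit)
        moreover have "grp i = v" "pos i = dig v a"
          using v dig_less by (auto simp: i_def)
        \<comment> \<open>Rows \<open>a\<close> and \<open>b\<close> involve the same two unknowns
          with roles exchanged, so exactly one of the equations carries
          \<open>\<gamma>\<close>.\<close>
        ultimately have "(if pos j < dig v a then 1 else \<gamma>) * C i b + C j a = 0"
          using dv jv ne by (simp add: coef_def)
        moreover have "(if dig v a < pos j then 1 else \<gamma>) * C j a + C i b = 0"
          using ja ne by simp
        ultimately show ?thesis
          using ne solve[of "C i b" "C j a"] solve[of "C j a" "C i b"]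
          by (cases "dig v a < pos j") (auto simp: add.commute[of "C j a" "C i b"])
      qed
    qed
  qed
qed

section \<open>The optimal access property\<close>

abbreviation code :: "(nat \<Rightarrow> nat \<Rightarrow> 'f) set" where
  "code \<equiv> parity_code r n l lam \<gamma>"

lemma in_code_iff:
  "C \<in> code \<longleftrightarrow> C \<in> array_space n l \<and> (\<forall>t<r. \<forall>a<l. syn C t a = 0)"
  by (simp add: parity_code_def syn_def)

lemma syn_add: "syn (C + D) t a = syn C t a + syn D t a"
  by (simp add: syn_def distrib_left sum.distrib)

lemma syn_scale: "syn (array_scale s C) t a = s * syn C t a"
  by (simp add: syn_def array_scale_def sum_distrib_left mult.left_commute)

lemma syn_diff: "syn (\<lambda>i b. C i b - D i b) t a = syn C t a - syn D t a"
  by (simp add: syn_def right_diff_distrib sum_subtractf)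

lemma array_space_diff:
  "C \<in> array_space n l \<Longrightarrow> D \<in> array_space n l \<Longrightarrow> (\<lambda>i b. C i b - D i b) \<in> array_space n l"
  by (simp add: array_space_def node_space_def)

lemma subspace_code: "array.subspace code"
proof (rule array.subspaceI)
  show "0 \<in> code"
    by (simp add: in_code_iff array_space_def node_space_def syn_def fun_eq_iff)
  show "C + D \<in> code" if "C \<in> code" "D \<in> code" for C D
    using that by (simp add: in_code_iff syn_add array_space_def node_space_def fun_eq_iff)
  show "array_scale s C \<in> code" if "C \<in> code" for s C
    using that
    by (simp add: in_code_iff syn_scale array_space_def node_space_def fun_eq_iff)
      (simp add: array_scale_def)
qed

text \<open>By linearity, \<open>erasure_trivial\<close> applies to the difference. Equal syndromes
  are assumed instead of zero ones because the counting argument compares arrays outside the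
  code.\<close>

lemma syn_determines_erasures:
  assumes T: "T \<subseteq> {1..n}" "card T \<le> r"
    and CD: "C \<in> array_space n l" "D \<in> array_space n l"
    and eq: "\<And>i. i \<in> {1..n} - T \<Longrightarrow> C i = D i"
    and syn: "\<And>t a. t < r \<Longrightarrow> a < l \<Longrightarrow> syn C t a = syn D t a"
  shows "C = D"
proof -
  let ?Z = "\<lambda>i b. C i b - D i b"
  have out: "?Z i = (\<lambda>_. 0)" if "i \<notin> T" for i
  proof (cases "i \<in> {1..n}")
    case True
    then show ?thesis
      using eq that by simp
  next
    case False
    then have "C i = (\<lambda>_. 0)" "D i = (\<lambda>_. 0)"
      using CD unfolding array_space_def by blast+
    then show ?thesis
      by simp
  qed
  have Z: "?Z \<in> array_space n l"
    using CD by (rule array_space_diff)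
  have "?Z i a = 0" for i a
  proof (cases "a < l")
    case True
    show ?thesis
      by (rule erasure_trivial[OF Z _ T out True]) (use syn in \<open>simp add: syn_diff\<close>)
  next
    case False
    show ?thesis
    proof (cases "i \<in> {1..n}")
      case True
      then have "?Z i \<in> node_space l"
        using Z unfolding array_space_def by blast
      then show ?thesis
        using False by (simp add: node_space_def)
    next
      case i: False
      then have "i \<notin> T"
        using T by blast
      then show ?thesis
        using fun_cong[OF out] by blast
    qed
  qed
  then show ?thesis
    by (simp add: fun_eq_iff)
qed

text \<open>
  Existence is a count: the syndromes of the \<open>q ^ (r * l)\<close> arrays extending \<open>X\<close> are pairwise
  distinct, and there are only \<open>q ^ (r * l)\<close> syndromes.
\<close>

lemma information_set_code:
  assumes S: "S \<subseteq> {1..n}" "card S = k"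
  shows "information_set l code S"
  unfolding information_set_def
proof (intro ballI ex_ex1I)
  fix X :: "nat \<Rightarrow> nat \<Rightarrow> 'f"
  assume X: "X \<in> S \<rightarrow> node_space l"
  define T where "T = {1..n} - S"
  have finS: "finite S"
    using S(1) finite_subset by blast
  have T: "T \<subseteq> {1..n}" "finite T" "card T = r"
    using S finS r_le_n k by (auto simp: T_def card_Diff_subset)
  show "C = D" if "C \<in> code \<and> (\<forall>i\<in>S. C i = X i)" "D \<in> code \<and> (\<forall>i\<in>S. D i = X i)" for C D
    using that T by (intro syn_determines_erasures[of T]) (auto simp: in_code_iff T_def)
  \<comment> \<open>\<open>E g\<close> keeps \<open>X\<close> on \<open>S\<close> and fills the
    erased nodes with the free symbols \<open>g\<close>.\<close>
  define E where "E g i a =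
    (if i \<in> S then X i a else if i \<in> T \<and> a < l then g (i, a) else 0)" for g :: "nat \<times> nat \<Rightarrow> 'f" and i a
  define \<Psi> where "\<Psi> g = restrict (\<lambda>(t, a). syn (E g) t a) ({..<r} \<times> {..<l})" for g
  let ?G = "PiE (T \<times> {..<l}) (\<lambda>_. UNIV :: 'f set)" and ?H = "PiE ({..<r} \<times> {..<l}) (\<lambda>_. UNIV :: 'f set)"
  have E: "E g \<in> array_space n l" for g
    using X S(1) by (auto simp: array_space_def node_space_def E_def T_def fun_eq_iff)
  have "inj_on \<Psi> ?G"
  proof (rule inj_onI)
    fix g h assume gh: "g \<in> ?G" "h \<in> ?G" "\<Psi> g = \<Psi> h"
    have "E g = E h"
    proof (rule syn_determines_erasures[OF T(1) eq_imp_le[OF T(3)] E E])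
      show "E g i = E h i" if "i \<in> {1..n} - T" for i
        using that by (auto simp: E_def T_def)
      show "syn (E g) t a = syn (E h) t a" if "t < r" "a < l" for t a
        using fun_cong[OF gh(3), of "(t, a)"] that by (simp add: \<Psi>_def)
    qed
    have "g (i, a) = h (i, a)" if "i \<in> T" "a < l" for i a
    proof -
      have "E g i a = E h i a"
        using \<open>E g = E h\<close> by (rule arg_cong)
      then show ?thesis
        using that by (simp add: E_def T_def)
    qed
    then show "g = h"
      by (intro PiE_ext[OF gh(1,2)]) auto
  qed
  moreover have "card ?G = card ?H"
    using T by (simp add: card_PiE card_cartesian_product)
  moreover have "\<Psi> ` ?G \<subseteq> ?H"
    unfolding \<Psi>_def image_subset_iff restrict_PiE_iff by simp
  \<comment> \<open>An injection between finite sets of equal size is onto, so some filling has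
    syndrome zero.\<close>
  ultimately have "\<Psi> ` ?G = ?H"
    by (intro card_subset_eq) (simp_all add: card_image finite_PiE)
  moreover have "restrict (\<lambda>_. 0) ({..<r} \<times> {..<l}) \<in> ?H"
    unfolding restrict_PiE_iff by simp
  ultimately obtain g where g: "\<Psi> g = restrict (\<lambda>_. 0) ({..<r} \<times> {..<l})"
    by (metis (no_types, lifting) image_iff)
  have "syn (E g) t a = 0" if "t < r" "a < l" for t a
    using fun_cong[OF g, of "(t, a)"] that by (simp add: \<Psi>_def)
  then have "E g \<in> code"
    using E by (simp add: in_code_iff)
  moreover have "\<forall>i\<in>S. E g i = X i"
    by (simp add: E_def fun_eq_iff)
  ultimately show "\<exists>C. C \<in> code \<and> (\<forall>i\<in>S. C i = X i)"
    by blast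
qed

text \<open>
  The parity checks in the rows \<open>a\<close> whose digit in the group of \<open>i\<close> points at \<open>i\<close> only involve
  coordinates with this property at the other nodes, but all coordinates of node \<open>i\<close>.
\<close>

lemma node_determined:
  assumes CD: "C \<in> code" "D \<in> code" and i: "i \<in> {1..n}"
    and eq: "\<And>j a. j \<in> {1..n} - {i} \<Longrightarrow> a < l \<Longrightarrow> dig (grp i) a = pos i \<Longrightarrow> C j a = D j a"
  shows "C i = D i"
proof
  fix b
  let ?Z = "\<lambda>i b. C i b - D i b"
  have Z: "?Z \<in> array_space n l"
    using CD by (intro array_space_diff) (auto simp: in_code_iff)
  define v where "v = grp i"
  have v: "1 \<le> v" "v \<le> m + 1"
    using i grp_le n_le by (auto simp: v_def)
  have iv: "node v (pos i) = i"
    using i by (simp add: v_def)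
  have zero: "?Z j a = 0" if "j \<noteq> i" "a < l" "dig v a = pos i" for j a
  proof (cases "j \<in> {1..n}")
    case True
    then show ?thesis
      using eq that by (simp add: v_def)
  next
    case False
    then have "?Z j = (\<lambda>_. 0)"
      using Z unfolding array_space_def by blast
    then show ?thesis
      by (rule fun_cong)
  qed
  show "C i b = D i b"
  proof (cases "b < l")
    case False
    have "C i \<in> node_space l" "D i \<in> node_space l"
      using CD i by (auto simp: in_code_iff array_space_def)
    then show ?thesis
      using False by (simp add: node_space_def)
  next
    case b: True
    \<comment> \<open>In row \<open>a\<close> the digit \<open>v\<close> points at \<open>i\<close>,
      so node \<open>i\<close> enters there with all coordinates that differ from \<open>a\<close>
      at most in digit \<open>v\<close>, among them \<open>b\<close>.\<close>
    define a where "a = rep v (pos i) b"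
    have a: "a < l"
      unfolding a_def by (rule rep_less[OF v pos_less b])
    have da: "dig v a = pos i"
      using v by (simp add: a_def digit_replace_digit)
    \<comment> \<open>\<open>T\<close> is the whole group of \<open>i\<close>, absent nodes
      included. \<open>j\<close> is the member whose coefficient in row \<open>a\<close> contains
      \<open>?Z i b\<close>.\<close>
    define T where "T = node v ` {..<r}"
    define j where "j = node v (dig v b)"
    have "coef ?Z a j = 0"
    proof (rule coef_eq_0[OF Z a, where T = T])
      show "syn ?Z t a = 0" if "t < r" for t
        using CD a that by (simp add: syn_diff in_code_iff)
      show "T \<subseteq> {1..r * (m + 1)}"
        unfolding T_def using node_in[OF v] by (rule image_subsetI) simp
      show "card T \<le> r"
        unfolding T_def using card_image_le[of "{..<r}" "node v"] by simp
      show "j \<in> T"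
        using dig_less by (simp add: T_def j_def)
      fix h assume h: "h \<in> {1..r * (m + 1)}" "h \<notin> T"
      then have h1: "1 \<le> h"
        by simp
      have ne: "grp h \<noteq> v"
      proof
        assume "grp h = v"
        then have "h = node v (pos h)"
          using node_grp_pos[OF h1] by simp
        then have "h \<in> T"
          unfolding T_def by (rule image_eqI) simp
        then show False
          using h by simp
      qed
      then have "?Z h a = 0"
        by (intro zero a da) (auto simp: v_def)
      \<comment> \<open>A node of another group is never \<open>i\<close>, and changing a digit of
        another group leaves digit \<open>v\<close> in place; the entry is therefore an accessed
        one.\<close>
      moreover have "?Z (node (grp h) (dig (grp h) a)) (rep (grp h) (pos h) a) = 0"
      proof (rule zero)
        have "grp (node (grp h) (dig (grp h) a)) = grp h"
          using dig_less by simp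
        then show "node (grp h) (dig (grp h) a) \<noteq> i"
          using ne v_def by metis
        show "rep (grp h) (pos h) a < l"
          using grp_le h by (intro rep_less a) auto
        show "dig v (rep (grp h) (pos h) a) = pos i"
          using da ne v by (simp add: digit_replace_digit_other)
      qed
      ultimately show "coef ?Z a h = 0"
        unfolding coef_def by simp
    qed
    moreover have "grp j = v" "pos j = dig v b"
      using v dig_less by (auto simp: j_def)
    moreover have "rep v (dig v b) a = b"
      using v by (simp add: a_def replace_digit_replace_digit replace_digit_digit)
    \<comment> \<open>If the digits agree, \<open>coef\<close> has no diagonal term; otherwise that
      term is an accessed entry of a helper.\<close>
    moreover have "?Z j a = 0" if "dig v b \<noteq> pos i"
    proof (rule zero[OF _ a da])
      show "j \<noteq> i"
        using that \<open>pos j = dig v b\<close> by auto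
    qed
    ultimately have "?Z i b = 0"
      unfolding coef_def using da iv by (cases "dig v b = pos i") simp_all
    then show ?thesis
      by simp
  qed
qed

text \<open>Reading the \<open>r ^ m\<close> coordinates whose digit points at \<open>i\<close> from
  each helper meets the cut-set bound, as \<open>l = r * r ^ m\<close> and
  \<open>n - k = r\<close>.\<close>

lemma min_access_code:
  assumes i: "i \<in> {1..n}"
  shows "min_access l code i ({1..n} - {i}) = (n - 1) * r ^ m"
  unfolding min_access_def
proof (rule Least_equality)
  have arr: "code \<subseteq> array_space n l"
    by (auto simp: in_code_iff)
  let ?J = "{a. a < l \<and> dig (grp i) a = pos i}"
  have "repairable_with_access l code i ({1..n} - {i}) (\<Sum>j\<in>{1..n} - {i}. card ?J)"
  proof (rule repairable_with_access_coordinates)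
    show "C i \<in> node_space l" if "C \<in> code" for C
      using arr that i by (auto simp: array_space_def)
    show "C i = D i" if "C \<in> code" "D \<in> code"
      "\<And>j a. j \<in> {1..n} - {i} \<Longrightarrow> a \<in> ?J \<Longrightarrow> C j a = D j a" for C D
      by (rule node_determined[OF that(1,2) i]) (use that(3) in simp)
  qed auto
  moreover have "grp i \<le> m + 1"
    using i n_le by (intro grp_le) auto
  then have "card ?J = r ^ m"
    unfolding l by (intro card_digit_eq) simp_all
  moreover have "card ({1..n} - {i}) = n - 1"
    using i by simp
  ultimately show "repairable_with_access l code i ({1..n} - {i}) ((n - 1) * r ^ m)"
    by simp
  fix w assume "repairable_with_access l code i ({1..n} - {i}) w"
  then have "(n - 1) * l \<le> (n - k) * w"
    using k_bounds by (intro repairable_with_access_ge[OF arr _ _ i information_set_code])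
  then have "r * ((n - 1) * r ^ m) \<le> r * w"
    using k r_le_n by (simp add: l ac_simps)
  then show "(n - 1) * r ^ m \<le> w"
    using r_pos by simp
qed

lemma optimal_access_code: "optimal_access n k l code"
proof -
  have "mds_array_code n k l code"
    using k_bounds
    by (intro mds_array_codeI subspace_code information_set_code) (auto simp: in_code_iff)
  \<comment> \<open>All nodes have the same minimal access, so the maximum is over a
    singleton.\<close>
  moreover have "(\<lambda>i. min_access l code i ({1..n} - {i})) ` {1..n} = {(n - 1) * r ^ m}"
    using k_bounds by (subst image_cong[OF refl min_access_code]) (auto simp: image_constant_conv)
  then have "code_access n l code = (n - 1) * r ^ m"
    by (simp add: code_access_def)
  moreover have "real n - real k = real r" "real (n - 1) = real n - 1"
    using k r_le_n k_bounds by (auto simp: of_nat_diff)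
  ultimately show ?thesis
    using r_pos by (simp add: optimal_access_def l)
qed

end

theorem theorem7:
  fixes r m r' n k l :: nat
    and lam :: "nat \<Rightarrow> 'f::{field,finite}"
    and \<gamma> :: 'f
  assumes "m \<ge> 1"
    and "1 \<le> r'" and "r' \<le> r - 1"
    and "n = r * m + r'"
    and "k = n - r"
    and "l = r ^ (m + 1)"
    and "CARD('f) \<ge> r * (m + 1)"
    and "inj_on lam {1..r * (m + 1)}"
    and "\<gamma> \<noteq> 0" and "\<gamma> \<noteq> 1"
  shows "optimal_access n k l (parity_code r n l lam \<gamma>)"
proof -
  interpret parity_setup r m r' n k l lam \<gamma>
    by unfold_locales fact+
  show ?thesis
    by (rule optimal_access_code)
qed

end
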